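(* In the control setting described in the context, with the standing assumptions (i)–(iv) on $V_\varepsilon$, $H$ and the optimal control and the assumption that $V_0$ is almost everywhere differentiable, let $\Omega$ be a compact subset of $\mathbb R$. Then: (i) There exists a constant $C=C(\Omega)$ such that $V_\varepsilon''(x)\ge C$ for all $x\in\Omega$ and all $\varepsilon<\varepsilon_0$. (ii) The family of functions $\{F_\varepsilon\}_{\varepsilon>0}$ converges locally uniformly, as $\varepsilon\to0$, to a function $F_0$ which is almost everywhere differentiable with $$F_0'(x)=-f(x,g(x,V_0'(x))).$$
   Context: Setting. Let $(\Omega_{\mathrm{prob}},\mathcal F,\{\mathcal F_t\}_{t\ge0},\mathbb P)$ be a filtered probability space satisfying the usual conditions with a Brownian motion $W$, let $U=(0,\infty)$ be the control space and $\rho>0$. For $\varepsilon>0$ consider $$dx^\varepsilon(t)=f(x^\varepsilon(t),u(t))dt+\sqrt{2\varepsilon}\,dW_t,\qquad x^\varepsilon(0)=x\in\mathbb R,$$ where $f\in C^1(\mathbb R\times U)$, $|f_x|\le C$, $|f(x,u)|\le C(1+|x|+|u|)$. Let $G$ be continuous on $\mathbb R\times U$ with $G(x,\cdot)\in C^1(U)$, and $$V_\varepsilon(x)=\sup_{u\in\mathfrak U}\mathbb E_x\Big[\int_0^\infty e^{-\rho s}G(x^\varepsilon(s),u(s))ds\Big],$$ where $\mathfrak U$ is the set of $\mathcal F_t$-adapted, $\mathbb P$-a.s. locally integrable $U$-valued processes $u$ for which the expectation above is $<\infty$ and the state equation has a unique strong solution. Assumptions. (i) $V_\varepsilon$ is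 a classical solution of $-\varepsilon V_\varepsilon''-H(x,V_\varepsilon')+\rho V_\varepsilon=0$, where $H(x,p)=\sup_{u\in U}\{f(x,u)p+G(x,u)\}$. (ii) There is $\varepsilon_0>0$ such that $V_\varepsilon$ and $V_\varepsilon'$ are bounded uniformly in $\varepsilon<\varepsilon_0$ on every compact subset of $\mathbb R$. (iii) $H$ is $C^2$ and $H_{pp}>0$. (iv) There is an optimal stationary Markov control policy $u^*(s)=g(x^*(s),V_\varepsilon'(x^*(s)))=:\bar u^*(x^*(s))$, with $g$ continuous, such that $f_u(x,\bar u^*(x))V_\varepsilon'(x)+G_u(x,\bar u^*(x))=0$. Limit. As $\varepsilon\to0$, $V_\varepsilon\to V_0$ locally uniformly, where $V_0$ is a viscosity solution of $-H(x,V_0')+\rho V_0=0$; it is assumed that $V_0$ is almost everywhere differentiable. Potential. $F_\varepsilon$ is defined by $F_\varepsilon'(x)=-f(x,g(x,V_\varepsilon'(x)))$, normalized by $F_\varepsilon(0)=0$. *)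

theory Defs
  imports "HOL-Probability.Probability"
begin

section \<open>Classes of smooth functions on open sets\<close>

definition C1_on :: "'a::real_normed_vector set \<Rightarrow> ('a \<Rightarrow> 'b::real_normed_vector) \<Rightarrow> bool" where
  "C1_on S h \<longleftrightarrow> (\<exists>D :: 'a \<Rightarrow> 'a \<Rightarrow>\<^sub>L 'b.
     (\<forall>z\<in>S. (h has_derivative blinfun_apply (D z)) (at z)) \<and> continuous_on S D)"

definition C2_on :: "'a::real_normed_vector set \<Rightarrow> ('a \<Rightarrow> 'b::real_normed_vector) \<Rightarrow> bool" where
  "C2_on S h \<longleftrightarrow> (\<exists>D :: 'a \<Rightarrow> 'a \<Rightarrow>\<^sub>L 'b.
     (\<forall>z\<in>S. (h has_derivative blinfun_apply (D z)) (at z)) \<and> C1_on S D)"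

section \<open>Filtered probability space and Brownian motion\<close>

text \<open>Time is \<open>[0, \<infinity>)\<close>. Processes and filtrations are indexed by all reals, but their values at
  negative times are irrelevant throughout.\<close>

definition filtered_space_usual :: "'w measure \<Rightarrow> (real \<Rightarrow> 'w measure) \<Rightarrow> bool" where
  "filtered_space_usual M F \<longleftrightarrow>
     prob_space M \<and>
     (\<forall>t\<ge>0. subalgebra M (F t)) \<and>
     (\<forall>s t. 0 \<le> s \<and> s \<le> t \<longrightarrow> sets (F s) \<subseteq> sets (F t)) \<and>
     (\<forall>t\<ge>0. sets (F t) = (\<Inter>s\<in>{t<..}. sets (F s))) \<and>
     complete_measure M \<and> null_sets M \<subseteq> sets (F 0)"

definition adapted :: "(real \<Rightarrow> 'w measure) \<Rightarrow> (real \<Rightarrow> 'w \<Rightarrow> real) \<Rightarrow> bool" where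
  "adapted F X \<longleftrightarrow> (\<forall>t\<ge>0. X t \<in> borel_measurable (F t))"

definition brownian_motion ::
  "'w measure \<Rightarrow> (real \<Rightarrow> 'w measure) \<Rightarrow> (real \<Rightarrow> 'w \<Rightarrow> real) \<Rightarrow> bool" where
  "brownian_motion M F W \<longleftrightarrow>
     adapted F W \<and>
     (AE \<omega> in M. W 0 \<omega> = 0) \<and>
     (AE \<omega> in M. continuous_on {0..} (\<lambda>t. W t \<omega>)) \<and>
     (\<forall>s t. 0 \<le> s \<and> s < t \<longrightarrow>
        distributed M lborel (\<lambda>\<omega>. W t \<omega> - W s \<omega>) (normal_density 0 (sqrt (t - s))) \<and>
        prob_space.indep_set M (sets (F s))
          (sets (vimage_algebra (space M) (\<lambda>\<omega>. W t \<omega> - W s \<omega>) borel)))"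

section \<open>The controlled state equation\<close>

text \<open>The noise is additive, so \<open>dx = f(x,u) dt + sqrt(2\<epsilon>) dW\<close> means the pathwise integral equation
  below, without a stochastic integral.\<close>

definition strong_solution ::
  "'w measure \<Rightarrow> (real \<Rightarrow> 'w measure) \<Rightarrow> (real \<Rightarrow> 'w \<Rightarrow> real) \<Rightarrow> (real \<Rightarrow> real \<Rightarrow> real) \<Rightarrow>
   real \<Rightarrow> real \<Rightarrow> (real \<Rightarrow> 'w \<Rightarrow> real) \<Rightarrow> (real \<Rightarrow> 'w \<Rightarrow> real) \<Rightarrow> bool" where
  "strong_solution M F W f \<epsilon> x u X \<longleftrightarrow>
     adapted F X \<and>
     (AE \<omega> in M. continuous_on {0..} (\<lambda>t. X t \<omega>)) \<and>
     (AE \<omega> in M. \<forall>t\<ge>0.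
        set_integrable lborel {0..t} (\<lambda>s. f (X s \<omega>) (u s \<omega>)) \<and>
        X t \<omega> = x + (LINT s:{0..t}|lborel. f (X s \<omega>) (u s \<omega>)) + sqrt (2 * \<epsilon>) * W t \<omega>)"

definition unique_strong_solution ::
  "'w measure \<Rightarrow> (real \<Rightarrow> 'w measure) \<Rightarrow> (real \<Rightarrow> 'w \<Rightarrow> real) \<Rightarrow> (real \<Rightarrow> real \<Rightarrow> real) \<Rightarrow>
   real \<Rightarrow> real \<Rightarrow> (real \<Rightarrow> 'w \<Rightarrow> real) \<Rightarrow> (real \<Rightarrow> 'w \<Rightarrow> real) \<Rightarrow> bool" where
  "unique_strong_solution M F W f \<epsilon> x u X \<longleftrightarrow>
     strong_solution M F W f \<epsilon> x u X \<and>
     (\<forall>Y. strong_solution M F W f \<epsilon> x u Y \<longrightarrow> (AE \<omega> in M. \<forall>t\<ge>0. Y t \<omega> = X t \<omega>))"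

section \<open>Payoff, admissible controls, value function\<close>

text \<open>Extended Lebesgue integral, positive part minus negative part. On \<^typ>\<open>ereal\<close> one has
  \<open>\<infinity> - \<infinity> = \<infinity>\<close>, so a value \<open>< \<infinity>\<close> means that the positive part has finite integral; in particular
  the integral is then well-defined as an element of \<open>[-\<infinity>, \<infinity>)\<close>.\<close>

definition ext_integral :: "'b measure \<Rightarrow> ('b \<Rightarrow> ereal) \<Rightarrow> ereal" where
  "ext_integral N Y =
     enn2ereal (\<integral>\<^sup>+ z. e2ennreal (Y z) \<partial>N) - enn2ereal (\<integral>\<^sup>+ z. e2ennreal (- Y z) \<partial>N)"

definition discounted_gain ::
  "real \<Rightarrow> (real \<Rightarrow> real \<Rightarrow> real) \<Rightarrow> (real \<Rightarrow> 'w \<Rightarrow> real) \<Rightarrow> (real \<Rightarrow> 'w \<Rightarrow> real) \<Rightarrow> 'w \<Rightarrow> ereal" where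
  "discounted_gain \<rho> G X u \<omega> =
     ext_integral (restrict_space lborel {0..}) (\<lambda>s. ereal (exp (- \<rho> * s) * G (X s \<omega>) (u s \<omega>)))"

definition payoff ::
  "'w measure \<Rightarrow> real \<Rightarrow> (real \<Rightarrow> real \<Rightarrow> real) \<Rightarrow> (real \<Rightarrow> 'w \<Rightarrow> real) \<Rightarrow> (real \<Rightarrow> 'w \<Rightarrow> real) \<Rightarrow> ereal"
  where "payoff M \<rho> G X u = ext_integral M (discounted_gain \<rho> G X u)"

text \<open>Membership of a control \<open>u\<close> in the admissible class (depending on the initial state \<open>x\<close>),
  together with the associated state process \<open>X\<close>, which is determined up to indistinguishability.
  Adapted processes need not be jointly measurable, so measurability of the random variable whose
  expectation is taken is demanded explicitly.\<close>

definition admissible ::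
  "'w measure \<Rightarrow> (real \<Rightarrow> 'w measure) \<Rightarrow> (real \<Rightarrow> 'w \<Rightarrow> real) \<Rightarrow> real \<Rightarrow>
   (real \<Rightarrow> real \<Rightarrow> real) \<Rightarrow> (real \<Rightarrow> real \<Rightarrow> real) \<Rightarrow> real \<Rightarrow> real \<Rightarrow>
   (real \<Rightarrow> 'w \<Rightarrow> real) \<Rightarrow> (real \<Rightarrow> 'w \<Rightarrow> real) \<Rightarrow> bool" where
  "admissible M F W \<rho> f G \<epsilon> x u X \<longleftrightarrow>
     adapted F u \<and>
     (\<forall>t\<ge>0. \<forall>\<omega>\<in>space M. 0 < u t \<omega>) \<and>
     (AE \<omega> in M. \<forall>T\<ge>0. set_integrable lborel {0..T} (\<lambda>s. u s \<omega>)) \<and>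
     unique_strong_solution M F W f \<epsilon> x u X \<and>
     discounted_gain \<rho> G X u \<in> borel_measurable M \<and>
     payoff M \<rho> G X u < \<infinity>"

definition value_function ::
  "'w measure \<Rightarrow> (real \<Rightarrow> 'w measure) \<Rightarrow> (real \<Rightarrow> 'w \<Rightarrow> real) \<Rightarrow> real \<Rightarrow>
   (real \<Rightarrow> real \<Rightarrow> real) \<Rightarrow> (real \<Rightarrow> real \<Rightarrow> real) \<Rightarrow> real \<Rightarrow> real \<Rightarrow> ereal" where
  "value_function M F W \<rho> f G \<epsilon> x =
     Sup {payoff M \<rho> G X u | u X. admissible M F W \<rho> f G \<epsilon> x u X}"

definition optimal_control ::
  "'w measure \<Rightarrow> (real \<Rightarrow> 'w measure) \<Rightarrow> (real \<Rightarrow> 'w \<Rightarrow> real) \<Rightarrow> real \<Rightarrow>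
   (real \<Rightarrow> real \<Rightarrow> real) \<Rightarrow> (real \<Rightarrow> real \<Rightarrow> real) \<Rightarrow> real \<Rightarrow> real \<Rightarrow>
   (real \<Rightarrow> 'w \<Rightarrow> real) \<Rightarrow> (real \<Rightarrow> 'w \<Rightarrow> real) \<Rightarrow> bool" where
  "optimal_control M F W \<rho> f G \<epsilon> x u X \<longleftrightarrow>
     admissible M F W \<rho> f G \<epsilon> x u X \<and>
     payoff M \<rho> G X u = value_function M F W \<rho> f G \<epsilon> x"

section \<open>Hamilton--Jacobi--Bellman equation\<close>

text \<open>The real supremum is meaningful only where the set is bounded above; finiteness has to be
  assumed separately.\<close>

definition hamiltonian ::
  "(real \<Rightarrow> real \<Rightarrow> real) \<Rightarrow> (real \<Rightarrow> real \<Rightarrow> real) \<Rightarrow> real \<Rightarrow> real \<Rightarrow> real" where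
  "hamiltonian f G x p = (SUP u\<in>{0<..}. f x u * p + G x u)"

definition hamiltonian_finite ::
  "(real \<Rightarrow> real \<Rightarrow> real) \<Rightarrow> (real \<Rightarrow> real \<Rightarrow> real) \<Rightarrow> bool" where
  "hamiltonian_finite f G \<longleftrightarrow> (\<forall>x p. bdd_above ((\<lambda>u. f x u * p + G x u) ` {0<..}))"

text \<open>Viscosity solutions of \<open>\<Phi>(x, v, v') = 0\<close> on the real line, by C1 test functions touching
  from above (subsolution) and from below (supersolution).\<close>

definition viscosity_solution ::
  "(real \<Rightarrow> real \<Rightarrow> real \<Rightarrow> real) \<Rightarrow> (real \<Rightarrow> real) \<Rightarrow> bool" where
  "viscosity_solution \<Phi> v \<longleftrightarrow>
     continuous_on UNIV v \<and>
     (\<forall>\<phi> x. C1_on UNIV \<phi> \<longrightarrow>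
        ((\<forall>\<^sub>F y in nhds x. v y - \<phi> y \<le> v x - \<phi> x) \<longrightarrow> \<Phi> x (v x) (deriv \<phi> x) \<le> 0) \<and>
        ((\<forall>\<^sub>F y in nhds x. v y - \<phi> y \<ge> v x - \<phi> x) \<longrightarrow> \<Phi> x (v x) (deriv \<phi> x) \<ge> 0))"

definition locally_uniform_limit ::
  "('i \<Rightarrow> real \<Rightarrow> real) \<Rightarrow> (real \<Rightarrow> real) \<Rightarrow> 'i filter \<Rightarrow> bool" where
  "locally_uniform_limit h l A \<longleftrightarrow> (\<forall>K. compact K \<longrightarrow> uniform_limit K h l A)"

end

theory Submission
  imports Defs
begin

text \<open>
  The argument is purely analytic: it combines the equation
  \<open>\<epsilon> V'' = \<rho> V - H(x, V')\<close>, the bounds on \<open>V\<close> and \<open>V'\<close> that are locally uniform in \<open>\<epsilon>\<close>,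
  and the continuity of the drift \<open>\<Phi>(x, p) = f(x, g(x, p))\<close>.

  \<^bold>\<open>Lower bound on the second derivative.\<close> Since \<open>H\<close> is \<open>C\<^sup>2\<close>, the equation can be
  differentiated twice, and \<open>z = - V''\<close> satisfies
  \<open>\<epsilon> z'' = \<rho> z + H\<^sub>x\<^sub>x - 2 H\<^sub>x\<^sub>p z + H\<^sub>p\<^sub>p z\<^sup>2 - H\<^sub>p z'\<close>. On a compact set the coefficients are
  bounded and \<open>H\<^sub>p\<^sub>p \<ge> c > 0\<close>, so at a large interior maximum of \<open>z\<close> the quadratic term would
  contradict \<open>z'' \<le> 0\<close>. As nothing is known about \<open>z\<close> at the ends of an interval \<open>[-S, S]\<close>,
  the maximum principle is applied to \<open>(S\<^sup>2 - x\<^sup>2)\<^sup>2 z\<close>, which vanishes there (Bernstein's method);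
  the weight is squared so that the terms produced by differentiating it are dominated by
  \<open>c z\<^sup>2\<close>. This is \<open>riccati_upper_bound\<close>, and the resulting bound depends on \<open>\<epsilon>\<close> only
  through an upper bound for \<open>\<epsilon>\<close>.

  \<^bold>\<open>Convergence of the potentials.\<close> By the first part the functions
  \<open>V\<^sub>\<epsilon> + C x\<^sup>2 / 2\<close> are convex near any given point, for one constant \<open>C\<close>. A locally uniform limit of
  convex functions also has convergent derivatives wherever the limit is differentiable, even
  jointly in the parameter and the point: \<open>V\<^sub>\<epsilon>'(y) \<rightarrow> V\<^sub>0'(x)\<close> as \<open>\<epsilon> \<rightarrow> 0\<close> and \<open>y \<rightarrow> x\<close>
  (\<open>semimonotone_derivatives_tendsto\<close>). Hence the derivatives \<open>- \<Phi>(y, V\<^sub>\<epsilon>'(y))\<close> of the potentials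
  are locally bounded and converge almost everywhere, and dominated convergence together with
  equi-Lipschitz continuity gives a locally uniform limit of the potentials. That the
  convergence is joint yields more: near a point \<open>x\<close> of differentiability of \<open>V\<^sub>0\<close> all derivatives
  with small \<open>\<epsilon>\<close> are close to the single number \<open>- \<Phi>(x, V\<^sub>0'(x))\<close>, so the mean value
  inequality passes to the limit and identifies the derivative of the limit at \<open>x\<close> itself,
  with no appeal to Lebesgue's differentiation theorem (\<open>limit_of_primitives\<close>).
\<close>

section \<open>A Bernstein estimate for a Riccati inequality\<close>

lemma local_max_second_derivative_nonpos:
  fixes \<phi> \<phi>' :: "real \<Rightarrow> real"
  assumes "open U" "x \<in> U"
    and d1: "\<And>y. y \<in> U \<Longrightarrow> (\<phi> has_real_derivative \<phi>' y) (at y)"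
    and d2: "(\<phi>' has_real_derivative l) (at x)"
    and mx: "\<And>y. y \<in> U \<Longrightarrow> \<phi> y \<le> \<phi> x"
  shows "\<phi>' x = 0" "l \<le> 0"
proof -
  obtain r where r: "0 < r" "\<And>y. \<bar>x - y\<bar> < r \<Longrightarrow> y \<in> U"
    using assms(1,2) by (metis dist_real_def open_dist abs_minus_commute)
  show z: "\<phi>' x = 0"
    by (rule DERIV_local_max[OF d1[OF assms(2)] r(1)]) (use mx r in auto)
  show "l \<le> 0"
  proof (rule ccontr)
    assume "\<not> l \<le> 0"
    then obtain d where d: "d > 0" "\<And>h. h > 0 \<Longrightarrow> h < d \<Longrightarrow> \<phi>' x < \<phi>' (x + h)"
      using DERIV_pos_inc_right[OF d2] by auto
    define h where "h = min d r / 2"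
    have h: "0 < h" "h < d" "h < r" using d(1) r(1) by (auto simp: h_def min_def)
    have inU: "y \<in> U" if "x \<le> y" "y \<le> x + h" for y using r(2) h that by auto
    have "\<phi> x < \<phi> (x + h)"
    proof (rule DERIV_pos_imp_increasing_open[of x "x + h" \<phi>])
      show "x < x + h" using h by simp
      show "continuous_on {x..x + h} \<phi>"
        by (rule DERIV_atLeastAtMost_imp_continuous_on) (use d1 inU in blast)
      fix y assume y: "x < y" "y < x + h"
      have "\<phi>' x < \<phi>' (x + (y - x))" by (rule d(2)) (use y h in auto)
      then show "\<exists>m. (\<phi> has_real_derivative m) (at y) \<and> m > 0"
        using d1 inU y z by (intro exI[of _ "\<phi>' y"]) auto
    qed
    then show False using mx[OF inU, of "x + h"] h by auto
  qed
qed

text \<open>The weighted function \<open>\<psi> = d\<^sup>2 z\<close> with \<open>d = S\<^sup>2 - x\<^sup>2\<close> is maximised. At an interior positive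
  maximum, \<open>\<psi>' = 0\<close> gives \<open>d z' = 4 x z\<close> and \<open>\<psi>'' \<le> 0\<close> gives
  \<open>d\<^sup>2 z'' \<le> (24 x\<^sup>2 + 4 d) z \<le> 28 S\<^sup>2 z\<close>. If moreover \<open>z \<ge> 1\<close> and \<open>c z \<ge> 6 N\<close>, half of \<open>c z\<^sup>2\<close> absorbs
  the lower order terms of the inequality. Multiplying what remains by \<open>d\<^sup>2 / z\<close> bounds
  \<open>c \<psi> / 2\<close>. The first entry of the maximum in the conclusion covers the case
  that \<open>z\<close> is not that large.\<close>

lemma riccati_upper_bound:
  fixes z z' z'' :: "real \<Rightarrow> real"
  assumes c: "0 < c" and N: "0 \<le> N" and S: "0 < S" and \<epsilon>: "0 < \<epsilon>" "\<epsilon> \<le> E"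
    and d1: "\<And>x. (z has_real_derivative z' x) (at x)"
    and d2: "\<And>x. (z' has_real_derivative z'' x) (at x)"
    and ineq: "\<And>x. \<lbrakk>\<bar>x\<bar> < S; 0 \<le> z x\<rbrakk> \<Longrightarrow> c * (z x)\<^sup>2 - 2 * N * z x - N - N * \<bar>z' x\<bar> \<le> \<epsilon> * z'' x"
    and x: "\<bar>x\<bar> \<le> S"
  shows "(S\<^sup>2 - x\<^sup>2)\<^sup>2 * z x \<le> max (S^4 * max 1 (6 * N / c)) ((2/c) * (28 * E * S\<^sup>2 + 4 * N * S^3))"
    (is "_ \<le> ?A")
proof -
  define \<psi> where "\<psi> = (\<lambda>x. (S\<^sup>2 - x\<^sup>2)\<^sup>2 * z x)"
  define \<psi>' where "\<psi>' = (\<lambda>x. (S\<^sup>2 - x\<^sup>2)\<^sup>2 * z' x - 4 * x * (S\<^sup>2 - x\<^sup>2) * z x)"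
  have der1: "(\<psi> has_real_derivative \<psi>' y) (at y)" for y
    unfolding \<psi>_def \<psi>'_def
    by (auto intro!: derivative_eq_intros d1 simp: algebra_simps)
  have der2: "(\<psi>' has_real_derivative
      ((S\<^sup>2 - y\<^sup>2)\<^sup>2 * z'' y - 8 * y * (S\<^sup>2 - y\<^sup>2) * z' y + (8 * y\<^sup>2 - 4 * (S\<^sup>2 - y\<^sup>2)) * z y)) (at y)" for y
    unfolding \<psi>'_def
    by (auto intro!: derivative_eq_intros d1 d2 simp: algebra_simps power2_eq_square)
  have "continuous_on {-S..S} \<psi>"
    by (rule DERIV_atLeastAtMost_imp_continuous_on) (use der1 in blast)
  moreover have "{-S..S} \<noteq> {}" using S by simp
  ultimately obtain m where m: "m \<in> {-S..S}" and mx: "\<And>y. y \<in> {-S..S} \<Longrightarrow> \<psi> y \<le> \<psi> m"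
    using continuous_attains_sup[OF compact_Icc] by metis
  have "\<psi> m \<le> ?A"
  proof (rule ccontr)
    assume "\<not> \<psi> m \<le> ?A"
    then have big: "?A < \<psi> m" by (simp only: not_le)
    then have big1: "S^4 * max 1 (6 * N / c) < \<psi> m"
      and big2: "(2/c) * (28 * E * S\<^sup>2 + 4 * N * S^3) < \<psi> m"
      by (simp_all only: max_less_iff_conj)
    have "0 < S^4 * max 1 (6 * N / c)" using S by (simp add: less_max_iff_disj)
    then have pos: "0 < \<psi> m" using big1 by linarith
    have mS: "\<bar>m\<bar> < S"
    proof (rule ccontr)
      assume "\<not> \<bar>m\<bar> < S"
      then have "\<bar>m\<bar> = S" using m by auto
      then have "m\<^sup>2 = S\<^sup>2" by (metis power2_abs)
      then show False using pos by (simp add: \<psi>_def)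
    qed
    define d where "d = S\<^sup>2 - m\<^sup>2"
    have d: "0 < d" "d \<le> S\<^sup>2"
      using mS by (auto simp: d_def abs_square_less_1 power2_strict_mono abs_less_iff power_strict_mono[of "\<bar>m\<bar>" S 2, simplified])
    have crit: "\<psi>' m = 0"
      and snd: "d\<^sup>2 * z'' m - 8 * m * d * z' m + (8 * m\<^sup>2 - 4 * d) * z m \<le> 0"
      unfolding d_def
      by (rule local_max_second_derivative_nonpos[OF open_greaterThanLessThan[of "-S" S] _ der1 der2];
          use mS mx in auto)+
    have zpos: "0 < z m" using pos d by (simp add: \<psi>_def d_def zero_less_mult_iff)
    have "S^4 * max 1 (6 * N / c) < d\<^sup>2 * z m" using big1 by (simp add: \<psi>_def d_def)
    also have "\<dots> \<le> S^4 * z m"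
    proof -
      have "d\<^sup>2 \<le> (S\<^sup>2)\<^sup>2" using d by (intro power_mono) auto
      then show ?thesis using zpos by (intro mult_right_mono) (auto simp: power_mult[symmetric])
    qed
    finally have "max 1 (6 * N / c) < z m" using S by (simp add: mult_less_cancel_left_pos)
    then have z1: "1 \<le> z m" and z2: "6 * N \<le> c * z m" using c by (auto simp: field_simps)
    have dz': "d * z' m = 4 * m * z m"
    proof -
      have "d * (d * z' m - 4 * m * z m) = 0"
        using crit by (simp add: \<psi>'_def d_def algebra_simps power2_eq_square)
      then show ?thesis using d by simp
    qed
    have m2: "m\<^sup>2 \<le> S\<^sup>2" using d d_def by simp
    have dz'': "d\<^sup>2 * z'' m \<le> 28 * S\<^sup>2 * z m"
    proof -
      have "d\<^sup>2 * z'' m \<le> 8 * m * (d * z' m) - (8 * m\<^sup>2 - 4 * d) * z m" using snd by (simp add: algebra_simps)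
      also have "\<dots> = (24 * m\<^sup>2 + 4 * d) * z m" unfolding dz' by (simp add: algebra_simps power2_eq_square)
      also have "\<dots> \<le> (28 * S\<^sup>2) * z m" using m2 d zpos by (intro mult_right_mono) auto
      finally show ?thesis .
    qed
    have key: "c / 2 * (z m)\<^sup>2 \<le> \<epsilon> * z'' m + N * \<bar>z' m\<bar>"
    proof -
      have a: "c / 2 * (z m)\<^sup>2 \<ge> 3 * N * z m"
        using mult_right_mono[OF z2, of "z m / 2"] zpos by (simp add: power2_eq_square algebra_simps)
      have b: "N \<le> N * z m" using z1 N by (simp add: mult_le_cancel_left1)
      show ?thesis using ineq[OF mS] zpos a b by (simp add: algebra_simps)
    qed
    have "c / 2 * (d\<^sup>2 * z m) * z m = d\<^sup>2 * (c / 2 * (z m)\<^sup>2)" by (simp add: power2_eq_square)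
    also have "\<dots> \<le> d\<^sup>2 * (\<epsilon> * z'' m + N * \<bar>z' m\<bar>)" using key by (intro mult_left_mono) auto
    also have "\<dots> = \<epsilon> * (d\<^sup>2 * z'' m) + N * d * \<bar>d * z' m\<bar>"
      using d by (simp add: algebra_simps power2_eq_square abs_mult)
    also have "\<dots> \<le> E * (28 * S\<^sup>2 * z m) + N * S\<^sup>2 * (4 * S * z m)"
    proof (rule add_mono)
      show "\<epsilon> * (d\<^sup>2 * z'' m) \<le> E * (28 * S\<^sup>2 * z m)"
        by (rule order_trans[OF mult_left_mono[OF dz''] mult_right_mono[OF \<epsilon>(2)]])
          (use \<epsilon> zpos in auto)
      show "N * d * \<bar>d * z' m\<bar> \<le> N * S\<^sup>2 * (4 * S * z m)"
        unfolding dz' using d zpos mS N by (intro mult_mono) (auto simp: abs_mult)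
    qed
    also have "\<dots> = (28 * E * S\<^sup>2 + 4 * N * S^3) * z m" by (simp add: algebra_simps power3_eq_cube power2_eq_square)
    finally have "c / 2 * (d\<^sup>2 * z m) \<le> 28 * E * S\<^sup>2 + 4 * N * S^3" using zpos by (simp add: mult_le_cancel_right)
    then have "d\<^sup>2 * z m \<le> (2/c) * (28 * E * S\<^sup>2 + 4 * N * S^3)" using c by (simp add: field_simps)
    then show False using big2 unfolding \<psi>_def d_def by linarith
  qed
  then show ?thesis using mx[of x] x by (auto simp: \<psi>_def abs_le_iff)
qed

section \<open>Partial derivatives of smooth functions\<close>

lemma has_real_derivative_along_plane_curve:
  fixes h :: "real \<Rightarrow> real \<Rightarrow> real"
  assumes h: "\<forall>x p. ((\<lambda>(x, p). h x p) has_derivative (\<lambda>(s, r). hx x p * s + hp x p * r)) (at (x, p))"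
    and a: "(a has_real_derivative a') (at t)" and b: "(b has_real_derivative b') (at t)"
  shows "((\<lambda>t. h (a t) (b t)) has_real_derivative hx (a t) (b t) * a' + hp (a t) (b t) * b') (at t)"
proof -
  have "((\<lambda>t. (a t, b t)) has_derivative (\<lambda>s. (a' * s, b' * s))) (at t)"
    using a b by (intro has_derivative_Pair) (auto simp: has_field_derivative_def)
  from has_derivative_compose[OF this h[rule_format]]
  have "((\<lambda>t. h (a t) (b t)) has_derivative
      (\<lambda>s. hx (a t) (b t) * (a' * s) + hp (a t) (b t) * (b' * s))) (at t)"
    by simp
  moreover have "(\<lambda>s. hx (a t) (b t) * (a' * s) + hp (a t) (b t) * (b' * s))
      = (*) (hx (a t) (b t) * a' + hp (a t) (b t) * b')"
    by (auto simp: algebra_simps)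
  ultimately show ?thesis by (simp only: has_field_derivative_def)
qed

lemma blinfun_plane_eq:
  fixes D :: "(real \<times> real) \<Rightarrow>\<^sub>L real"
  shows "blinfun_apply D = (\<lambda>(s, r). D (1, 0) * s + D (0, 1) * r)"
proof (intro ext, clarify)
  fix s r :: real
  have "(s, r) = s *\<^sub>R (1, 0) + r *\<^sub>R (0, 1::real)" by simp
  then show "D (s, r) = D (1, 0) * s + D (0, 1) * r"
    by (simp only: blinfun.add_right blinfun.scaleR_right) simp
qed

lemma C1_on_plane_partials:
  fixes h :: "real \<Rightarrow> real \<Rightarrow> real"
  assumes "C1_on UNIV (\<lambda>(x, p). h x p)"
  obtains hx hp where "continuous_on UNIV (\<lambda>(x, p). hx x p)" "continuous_on UNIV (\<lambda>(x, p). hp x p)"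
    "\<forall>x p. ((\<lambda>(x, p). h x p) has_derivative (\<lambda>(s, r). hx x p * s + hp x p * r)) (at (x, p))"
proof -
  obtain D :: "real \<times> real \<Rightarrow> (real \<times> real) \<Rightarrow>\<^sub>L real"
    where D: "\<And>z. ((\<lambda>(x, p). h x p) has_derivative blinfun_apply (D z)) (at z)"
      and D': "continuous_on UNIV D"
    using assms by (auto simp: C1_on_def)
  show ?thesis
  proof
    show "continuous_on UNIV (\<lambda>(x, p). D (x, p) (1, 0))" "continuous_on UNIV (\<lambda>(x, p). D (x, p) (0, 1))"
      using D' by (auto simp: case_prod_beta intro!: continuous_intros)
    show "\<forall>x p. ((\<lambda>(x, p). h x p) has_derivative (\<lambda>(s, r). D (x, p) (1, 0) * s + D (x, p) (0, 1) * r))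
        (at (x, p))"
      using D by (subst blinfun_plane_eq[symmetric]) blast
  qed
qed

lemma C1_on_blinfun_apply:
  fixes D :: "'a::real_normed_vector \<Rightarrow> 'b::real_normed_vector \<Rightarrow>\<^sub>L 'c::real_normed_vector"
  assumes "C1_on S D"
  shows "C1_on S (\<lambda>z. D z v)"
proof -
  obtain D2 where D2: "\<And>z. z \<in> S \<Longrightarrow> (D has_derivative blinfun_apply (D2 z)) (at z)"
    and c: "continuous_on S D2"
    using assms by (auto simp: C1_on_def)
  define E :: "('b \<Rightarrow>\<^sub>L 'c) \<Rightarrow>\<^sub>L 'c" where "E = Blinfun (\<lambda>A. blinfun_apply A v)"
  have bl: "bounded_linear (\<lambda>A :: 'b \<Rightarrow>\<^sub>L 'c. blinfun_apply A v)"
    by (rule bounded_linear_intros)+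
  have E: "blinfun_apply E A = A v" for A
    unfolding E_def by (subst bounded_linear_Blinfun_apply[OF bl]) simp
  show ?thesis
    unfolding C1_on_def
  proof (intro exI conjI ballI)
    show "continuous_on S (\<lambda>z. E o\<^sub>L D2 z)" by (intro continuous_intros c)
    fix z assume "z \<in> S"
    from bounded_linear.has_derivative[OF bl D2[OF this]]
    show "((\<lambda>z. D z v) has_derivative blinfun_apply (E o\<^sub>L D2 z)) (at z)"
      by (simp add: E comp_def blinfun_compose.rep_eq)
  qed
qed

lemma C2_on_plane_partials:
  fixes h :: "real \<Rightarrow> real \<Rightarrow> real"
  assumes "C2_on UNIV (\<lambda>(x, p). h x p)"
  obtains hx hp where "C1_on UNIV (\<lambda>(x, p). hx x p)" "C1_on UNIV (\<lambda>(x, p). hp x p)"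
    "\<forall>x p. ((\<lambda>(x, p). h x p) has_derivative (\<lambda>(s, r). hx x p * s + hp x p * r)) (at (x, p))"
proof -
  obtain D :: "real \<times> real \<Rightarrow> (real \<times> real) \<Rightarrow>\<^sub>L real"
    where D: "\<And>z. ((\<lambda>(x, p). h x p) has_derivative blinfun_apply (D z)) (at z)"
      and D': "C1_on UNIV D"
    using assms by (auto simp: C2_on_def)
  show ?thesis
  proof
    show "C1_on UNIV (\<lambda>(x, p). D (x, p) (1, 0))" "C1_on UNIV (\<lambda>(x, p). D (x, p) (0, 1))"
      using C1_on_blinfun_apply[OF D', of "(1, 0)"] C1_on_blinfun_apply[OF D', of "(0, 1)"]
      by (simp_all add: split_def)
    show "\<forall>x p. ((\<lambda>(x, p). h x p) has_derivative (\<lambda>(s, r). D (x, p) (1, 0) * s + D (x, p) (0, 1) * r))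
        (at (x, p))"
      using D by (subst blinfun_plane_eq[symmetric]) blast
  qed
qed

lemma C2_on_real_derivatives:
  fixes v :: "real \<Rightarrow> real"
  assumes "C2_on UNIV v"
  shows "(v has_real_derivative deriv v x) (at x)"
    and "(deriv v has_real_derivative deriv (deriv v) x) (at x)"
proof -
  obtain D :: "real \<Rightarrow> real \<Rightarrow>\<^sub>L real"
    where D: "\<And>z. (v has_derivative blinfun_apply (D z)) (at z)" and cD: "C1_on UNIV D"
    using assms by (auto simp: C2_on_def)
  have v': "(v has_real_derivative D y 1) (at y)" for y
  proof -
    have "blinfun_apply (D y) = (*) (blinfun_apply (D y) 1)"
    proof
      fix s show "D y s = D y 1 * s" using blinfun.scaleR_right[of "D y" s 1] by simp
    qed
    then show ?thesis unfolding has_field_derivative_def using D[of y] by metis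
  qed
  have dv: "deriv v = (\<lambda>y. D y 1)" using DERIV_imp_deriv[OF v'] by auto
  show "(v has_real_derivative deriv v x) (at x)" using v' by (simp add: dv)
  have "deriv v differentiable (at x)"
    using C1_on_blinfun_apply[OF cD, of 1] unfolding dv C1_on_def differentiable_def by auto
  then show "(deriv v has_real_derivative deriv (deriv v) x) (at x)"
    by (simp add: DERIV_deriv_iff_real_differentiable)
qed

section \<open>Uniform semiconvexity of viscous solutions\<close>

text \<open>The solution \<open>v\<close> is only assumed to be \<open>C\<^sup>2\<close>, but the equation expresses \<open>v''\<close> through
  \<open>v\<close>, \<open>v'\<close> and \<open>H\<close>, which makes \<open>v''\<close> differentiable; the same argument applied to the
  differentiated equation makes it twice differentiable. With \<open>- v''\<close> shown to satisfy a Riccati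
  inequality whose constants do not involve \<open>\<epsilon>\<close>, the weighted bound on an interval \<open>[-S, S]\<close>
  strictly larger than \<open>K\<close> can be divided by the weight on \<open>K\<close>. The term \<open>\<rho> z\<close> has a favourable
  sign wherever \<open>z \<ge> 0\<close>.\<close>

lemma viscous_HJ_second_derivative_lower_bound:
  fixes H :: "real \<Rightarrow> real \<Rightarrow> real" and v :: "real \<Rightarrow> real \<Rightarrow> real" and \<rho> :: real
  assumes rho: "0 \<le> \<rho>"
    and H: "C2_on UNIV (\<lambda>(x, p). H x p)"
    and Hpp: "\<And>x p. deriv (deriv (H x)) p > 0"
    and v: "\<And>\<epsilon>. \<epsilon> \<in> {0<..<E} \<Longrightarrow> C2_on UNIV (v \<epsilon>)"
    and eq: "\<And>\<epsilon> x. \<epsilon> \<in> {0<..<E} \<Longrightarrow>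
      - \<epsilon> * deriv (deriv (v \<epsilon>)) x - H x (deriv (v \<epsilon>) x) + \<rho> * v \<epsilon> x = 0"
    and bd: "\<And>A. compact A \<Longrightarrow> \<exists>B. \<forall>\<epsilon>\<in>{0<..<E}. \<forall>x\<in>A. \<bar>deriv (v \<epsilon>) x\<bar> \<le> B"
    and K: "compact K"
  shows "\<exists>C. \<forall>\<epsilon>\<in>{0<..<E}. \<forall>x\<in>K. C \<le> deriv (deriv (v \<epsilon>)) x"
proof -
  obtain hx hp where hx: "C1_on UNIV (\<lambda>(x, p). hx x p)" and hp: "C1_on UNIV (\<lambda>(x, p). hp x p)"
    and dH: "\<forall>x p. ((\<lambda>(x, p). H x p) has_derivative (\<lambda>(s, r). hx x p * s + hp x p * r)) (at (x, p))"
    by (rule C2_on_plane_partials[OF H], rule that, assumption+)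
  obtain hxx hxp where cxx: "continuous_on UNIV (\<lambda>(x, p). hxx x p)" and cxp: "continuous_on UNIV (\<lambda>(x, p). hxp x p)"
    and dhx: "\<forall>x p. ((\<lambda>(x, p). hx x p) has_derivative (\<lambda>(s, r). hxx x p * s + hxp x p * r)) (at (x, p))"
    by (rule C1_on_plane_partials[OF hx], rule that, assumption+)
  obtain hpx hpp where cpx: "continuous_on UNIV (\<lambda>(x, p). hpx x p)" and cpp: "continuous_on UNIV (\<lambda>(x, p). hpp x p)"
    and dhp: "\<forall>x p. ((\<lambda>(x, p). hp x p) has_derivative (\<lambda>(s, r). hpx x p * s + hpp x p * r)) (at (x, p))"
    by (rule C1_on_plane_partials[OF hp], rule that, assumption+)
  note chH = has_real_derivative_along_plane_curve[OF dH]
    and chx = has_real_derivative_along_plane_curve[OF dhx]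
    and chp = has_real_derivative_along_plane_curve[OF dhp]
  have cp: "continuous_on UNIV (\<lambda>(x, p). hp x p)"
    using dhp by (intro continuous_at_imp_continuous_on ballI) (metis has_derivative_continuous surj_pair)
  have hpp_pos: "hpp x p > 0" for x p
  proof -
    have "deriv (H x) = hp x"
      using DERIV_imp_deriv[OF chH[of "\<lambda>_. x" 0 _ "\<lambda>t. t" 1]] by (auto intro!: derivative_eq_intros)
    moreover have "deriv (hp x) p = hpp x p"
      using DERIV_imp_deriv[OF chp[of "\<lambda>_. x" 0 p "\<lambda>t. t" 1]] by (auto intro!: derivative_eq_intros)
    ultimately show ?thesis using Hpp[of x p] by simp
  qed
  obtain R where R: "0 < R" "\<And>x. x \<in> K \<Longrightarrow> \<bar>x\<bar> \<le> R"
    using compact_imp_bounded[OF K] bounded_pos[of K] by auto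
  define S where "S = R + 1"
  have S: "0 < S" "R < S" using R by (auto simp: S_def)
  obtain B where "\<forall>\<epsilon>\<in>{0<..<E}. \<forall>x\<in>{-S..S}. \<bar>deriv (v \<epsilon>) x\<bar> \<le> B"
    using bd[OF compact_Icc] by blast
  then have B: "\<bar>deriv (v \<epsilon>) x\<bar> \<le> B" if "\<epsilon> \<in> {0<..<E}" "\<bar>x\<bar> \<le> S" for \<epsilon> x
    using that by (simp add: abs_le_iff)
  define Q where "Q = {-S..S} \<times> {-\<bar>B\<bar>..\<bar>B\<bar>}"
  have Q: "compact Q" "Q \<noteq> {}" unfolding Q_def using S by (auto intro!: compact_Times)
  have inQ: "(x, deriv (v \<epsilon>) x) \<in> Q" if "\<epsilon> \<in> {0<..<E}" "\<bar>x\<bar> \<le> S" for \<epsilon> x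
    using B[OF that] that by (auto simp: Q_def)
  have bdd: "\<exists>N. \<forall>x p. (x, p) \<in> Q \<longrightarrow> \<bar>k x p\<bar> \<le> N"
    if "continuous_on UNIV (\<lambda>(x, p). k x p)" for k :: "real \<Rightarrow> real \<Rightarrow> real"
  proof -
    have "bounded ((\<lambda>(x, p). k x p) ` Q)"
      using continuous_on_subset[OF that] Q by (intro compact_imp_bounded compact_continuous_image) auto
    then show ?thesis unfolding bounded_iff by fastforce
  qed
  obtain N1 N2 N3 N4 where
    N1: "\<And>x p. (x, p) \<in> Q \<Longrightarrow> \<bar>hxx x p\<bar> \<le> N1" and N2: "\<And>x p. (x, p) \<in> Q \<Longrightarrow> \<bar>hxp x p\<bar> \<le> N2" and
    N3: "\<And>x p. (x, p) \<in> Q \<Longrightarrow> \<bar>hpx x p\<bar> \<le> N3" and N4: "\<And>x p. (x, p) \<in> Q \<Longrightarrow> \<bar>hp x p\<bar> \<le> N4"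
    using bdd[OF cxx] bdd[OF cxp] bdd[OF cpx] bdd[OF cp] by metis
  define N where "N = Max {0, N1, N2, N3, N4}"
  have N: "0 \<le> N" "N1 \<le> N" "N2 \<le> N" "N3 \<le> N" "N4 \<le> N" unfolding N_def by (auto intro: Max_ge)
  obtain c where c: "0 < c" "\<And>x p. (x, p) \<in> Q \<Longrightarrow> c \<le> hpp x p"
  proof -
    obtain q where "q \<in> Q" "\<And>r. r \<in> Q \<Longrightarrow> (\<lambda>(x, p). hpp x p) q \<le> (\<lambda>(x, p). hpp x p) r"
      using continuous_attains_inf[OF Q continuous_on_subset[OF cpp]] by blast
    then show ?thesis using hpp_pos by (intro that[of "(\<lambda>(x, p). hpp x p) q"]) (auto split: prod.splits)
  qed
  define A where "A = max (S^4 * max 1 (6 * N / c)) ((2/c) * (28 * E * S\<^sup>2 + 4 * N * S^3))"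
  have bound: "(S\<^sup>2 - x\<^sup>2)\<^sup>2 * (- deriv (deriv (v \<epsilon>)) x) \<le> A" if \<epsilon>: "\<epsilon> \<in> {0<..<E}" and x: "\<bar>x\<bar> \<le> S" for \<epsilon> x
  proof -
    define p where "p = deriv (v \<epsilon>)"
    define w where "w = deriv p"
    have dv: "(v \<epsilon> has_real_derivative p y) (at y)" and dp: "(p has_real_derivative w y) (at y)" for y
      unfolding p_def w_def using C2_on_real_derivatives[OF v[OF \<epsilon>]] by auto
    have e0: "\<epsilon> > 0" using \<epsilon> by simp
    have w: "w = (\<lambda>y. (\<rho> * v \<epsilon> y - H y (p y)) / \<epsilon>)"
    proof
      fix y show "w y = (\<rho> * v \<epsilon> y - H y (p y)) / \<epsilon>"
        using eq[OF \<epsilon>, of y] e0 by (simp add: w_def p_def field_simps)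
    qed
    \<comment> \<open>\<open>w'\<close> and \<open>w''\<close> are obtained by differentiating the equation along \<open>y \<mapsto> (y, p y)\<close>.
      The two mixed partial derivatives of \<open>H\<close> are kept apart, since only their size matters.\<close>
    define w' where "w' = (\<lambda>y. (\<rho> * p y - (hx y (p y) + hp y (p y) * w y)) / \<epsilon>)"
    have dw: "(w has_real_derivative w' y) (at y)" for y
      by (subst w) (unfold w'_def, use e0 chH[OF DERIV_ident dp] dv in \<open>auto intro!: derivative_eq_intros\<close>)
    define w'' where "w'' = (\<lambda>y. (\<rho> * w y - ((hxx y (p y) + hxp y (p y) * w y)
        + ((hpx y (p y) + hpp y (p y) * w y) * w y + w' y * hp y (p y)))) / \<epsilon>)"
    have dw': "(w' has_real_derivative w'' y) (at y)" for y
      unfolding w''_def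
      by (subst w'_def) (use chx[OF DERIV_ident dp] chp[OF DERIV_ident dp] dp dw e0 in
         \<open>auto intro!: derivative_eq_intros simp: mult.commute\<close>)
    have "(S\<^sup>2 - x\<^sup>2)\<^sup>2 * (- w x) \<le> A"
      unfolding A_def
    proof (rule riccati_upper_bound[where z = "\<lambda>y. - w y" and z' = "\<lambda>y. - w' y" and z'' = "\<lambda>y. - w'' y" and \<epsilon> = \<epsilon>])
      fix y assume y: "\<bar>y\<bar> < S" "0 \<le> - w y"
      have q: "(y, p y) \<in> Q" using inQ[OF \<epsilon>, of y] y by (simp add: p_def)
      have "\<epsilon> * (- w'' y) = \<rho> * (- w y) + hxx y (p y) - (hxp y (p y) + hpx y (p y)) * (- w y)
          + hpp y (p y) * (- w y)\<^sup>2 - hp y (p y) * (- w' y)"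
      proof -
        have "\<epsilon> * w'' y = \<rho> * w y - ((hxx y (p y) + hxp y (p y) * w y)
            + ((hpx y (p y) + hpp y (p y) * w y) * w y + w' y * hp y (p y)))"
          using e0 by (simp add: w''_def)
        then show ?thesis by (simp add: algebra_simps power2_eq_square)
      qed
      moreover have "0 \<le> \<rho> * (- w y)" using rho y by (intro mult_nonneg_nonneg) auto
      moreover have "- N \<le> hxx y (p y)" using N1[OF q] N by linarith
      moreover have "(hxp y (p y) + hpx y (p y)) * (- w y) \<le> (2 * N) * (- w y)"
        using N2[OF q] N3[OF q] N y by (intro mult_right_mono) linarith+
      moreover have "c * (- w y)\<^sup>2 \<le> hpp y (p y) * (- w y)\<^sup>2"
        using c(2)[OF q] by (intro mult_right_mono) auto
      moreover have "hp y (p y) * (- w' y) \<le> N * \<bar>- w' y\<bar>"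
      proof -
        have "hp y (p y) * (- w' y) \<le> \<bar>hp y (p y)\<bar> * \<bar>- w' y\<bar>" by (metis abs_ge_self abs_mult)
        also have "\<dots> \<le> N * \<bar>- w' y\<bar>" using N4[OF q] N by (intro mult_right_mono) auto
        finally show ?thesis .
      qed
      ultimately show "c * (- w y)\<^sup>2 - 2 * N * (- w y) - N - N * \<bar>- w' y\<bar> \<le> \<epsilon> * (- w'' y)"
        by linarith
    qed (use c N S \<epsilon> x dw dw' in \<open>auto intro!: derivative_intros\<close>)
    then show ?thesis by (simp add: w_def p_def)
  qed
  show ?thesis
  proof (intro exI ballI)
    fix \<epsilon> x assume \<epsilon>: "\<epsilon> \<in> {0<..<E}" and x: "x \<in> K"
    define d where "d = S\<^sup>2 - R\<^sup>2"
    have d: "0 < d" using S R by (simp add: d_def power_strict_mono)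
    have "x\<^sup>2 \<le> R\<^sup>2" using R(2)[OF x] R(1) by (metis abs_le_square_iff abs_of_pos)
    then have dx: "d\<^sup>2 \<le> (S\<^sup>2 - x\<^sup>2)\<^sup>2" using d by (intro power_mono) (auto simp: d_def)
    have A0: "0 \<le> A" using S by (simp add: A_def le_max_iff_disj)
    show "- (A / d\<^sup>2) \<le> deriv (deriv (v \<epsilon>)) x"
    proof (cases "0 \<le> deriv (deriv (v \<epsilon>)) x")
      case True
      then show ?thesis using A0 by (smt (verit) divide_nonneg_nonneg zero_le_power2)
    next
      case False
      have "\<bar>x\<bar> \<le> S" using R(2)[OF x] S by simp
      have "d\<^sup>2 * (- deriv (deriv (v \<epsilon>)) x) \<le> (S\<^sup>2 - x\<^sup>2)\<^sup>2 * (- deriv (deriv (v \<epsilon>)) x)"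
        using dx False by (intro mult_right_mono) auto
      also have "\<dots> \<le> A" by (rule bound) fact+
      finally show ?thesis using d by (simp add: field_simps)
    qed
  qed
qed


section \<open>Convergence of derivatives of semiconvex functions\<close>

lemma uniform_limit_tendsto_joint:
  fixes v :: "'i \<Rightarrow> 'a::metric_space \<Rightarrow> 'b::metric_space"
  assumes u: "uniform_limit U v v0 A" and U: "\<forall>\<^sub>F y in B. t y \<in> U"
    and t: "((\<lambda>y. v0 (t y)) \<longlongrightarrow> l) B"
  shows "((\<lambda>(i, y). v i (t y)) \<longlongrightarrow> l) (A \<times>\<^sub>F B)"
proof (rule tendstoI)
  fix e :: real assume e: "0 < e"
  have "\<forall>\<^sub>F i in A. \<forall>y\<in>U. dist (v i y) (v0 y) < e / 2"
    using uniform_limitD[OF u, of "e / 2"] e by simp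
  moreover have "\<forall>\<^sub>F y in B. t y \<in> U \<and> dist (v0 (t y)) l < e / 2"
    using eventually_conj[OF U tendstoD[OF t, of "e / 2"]] e by simp
  ultimately show "\<forall>\<^sub>F z in A \<times>\<^sub>F B. dist (case z of (i, y) \<Rightarrow> v i (t y)) l < e"
    unfolding eventually_prod_filter
    by (smt (verit) dist_triangle case_prod_conv field_sum_of_halves)
qed

text \<open>Semimonotonicity of \<open>p = v'\<close> traps the derivative between difference quotients of one fixed
  step \<open>h\<close>:
  \<open>(v(y) - v(y - h)) / h - C h \<le> p(y) \<le> (v(y + h) - v(y)) / h + C h\<close>. First \<open>h\<close> is chosen so that the
  quotients of the limit at \<open>x\<close> are close to its derivative and \<open>C h\<close> is small; for this fixed
  \<open>h\<close> the quotients of \<open>v\<close> at \<open>y\<close> converge, jointly in index and point, by uniform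
  convergence and continuity.\<close>

lemma semimonotone_derivatives_tendsto:
  fixes v p :: "'i \<Rightarrow> real \<Rightarrow> real" and v0 :: "real \<Rightarrow> real"
  assumes r: "0 < r" and C: "0 \<le> C"
    and der: "\<forall>\<^sub>F i in A. \<forall>y\<in>{x - r..x + r}. (v i has_real_derivative p i y) (at y)"
    and semi: "\<forall>\<^sub>F i in A. \<forall>y\<in>{x - r..x + r}. \<forall>z\<in>{x - r..x + r}. y \<le> z \<longrightarrow> p i y - C * (z - y) \<le> p i z"
    and lim: "uniform_limit {x - r..x + r} v v0 A"
    and cont: "continuous_on UNIV v0"
    and diff: "(v0 has_real_derivative l) (at x)"
  shows "((\<lambda>(i, y). p i y) \<longlongrightarrow> l) (A \<times>\<^sub>F nhds x)"
proof (rule tendstoI)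
  fix e :: real assume e: "0 < e"
  have slope: "(\<lambda>h. (v0 (x + h) - v0 x) / h) \<midarrow>0\<rightarrow> l" using diff by (simp add: DERIV_def)
  have "\<forall>\<^sub>F h in at 0. dist ((v0 (x + h) - v0 x) / h) l < e / 3"
    using tendstoD[OF slope, of "e / 3"] e by simp
  then obtain d where d: "0 < d" "\<And>h. h \<noteq> 0 \<Longrightarrow> \<bar>h\<bar> < d \<Longrightarrow> dist ((v0 (x + h) - v0 x) / h) l < e / 3"
    by (auto simp: eventually_at dist_real_def)
  define h where "h = Min {d / 2, r / 2, e / (3 * (C + 1))}"
  have h: "0 < h" "h < d" "h \<le> r / 2" "h \<le> e / (3 * (C + 1))"
    using d r e C by (auto simp: h_def min_def)
  have "C * h \<le> (C + 1) * h" using h C by (intro mult_right_mono) auto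
  also have "\<dots> \<le> (C + 1) * (e / (3 * (C + 1)))" using h C by (intro mult_left_mono) auto
  also have "\<dots> = e / 3" using C by (simp add: field_simps)
  finally have Ch: "C * h \<le> e / 3" .
  have near: "\<forall>\<^sub>F y in nhds x. dist y x < h" using h by (auto simp: eventually_nhds_metric)
  have quot: "\<forall>\<^sub>F z in A \<times>\<^sub>F nhds x. case z of (i, y) \<Rightarrow> dist ((v i (y + k) - v i y) / k) l < 2 * e / 3"
    if k: "\<bar>k\<bar> = h" for k
  proof -
    have joint: "((\<lambda>(i, y). v i (y + s)) \<longlongrightarrow> v0 (x + s)) (A \<times>\<^sub>F nhds x)" if s: "\<bar>s\<bar> \<le> h" for s
    proof (rule uniform_limit_tendsto_joint[OF lim])
      show "\<forall>\<^sub>F y in nhds x. y + s \<in> {x - r..x + r}"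
        by (rule eventually_mono[OF near]) (use h s in \<open>auto simp: dist_real_def abs_le_iff abs_less_iff\<close>)
      have "isCont (\<lambda>y. v0 (y + s)) x"
        using continuous_on_compose2[OF cont, of UNIV "\<lambda>y. y + s"]
        by (simp add: continuous_on_eq_continuous_at continuous_intros)
      then show "((\<lambda>y. v0 (y + s)) \<longlongrightarrow> v0 (x + s)) (nhds x)"
        using tendsto_at_iff_tendsto_nhds[of "\<lambda>y. v0 (y + s)" x] by (simp add: isCont_def)
    qed
    have "((\<lambda>(i, y). (v i (y + k) - v i y) / k) \<longlongrightarrow> (v0 (x + k) - v0 x) / k) (A \<times>\<^sub>F nhds x)"
      using tendsto_divide[OF tendsto_diff[OF joint[of k] joint[of 0]] tendsto_const[of k]] k h
      by (auto simp: split_def)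
    then have "\<forall>\<^sub>F z in A \<times>\<^sub>F nhds x.
        dist (case z of (i, y) \<Rightarrow> (v i (y + k) - v i y) / k) ((v0 (x + k) - v0 x) / k) < e / 3"
      using e by (auto dest: tendstoD[of _ _ _ "e / 3"])
    moreover have "dist ((v0 (x + k) - v0 x) / k) l < e / 3" by (rule d(2)) (use k h in auto)
    ultimately show ?thesis
    proof (elim eventually_mono, clarify)
      fix i y assume "dist ((v i (y + k) - v i y) / k) ((v0 (x + k) - v0 x) / k) < e / 3"
        and "dist ((v0 (x + k) - v0 x) / k) l < e / 3"
      then show "dist ((v i (y + k) - v i y) / k) l < 2 * e / 3"
        using dist_triangle[of "(v i (y + k) - v i y) / k" l "(v0 (x + k) - v0 x) / k"] by linarith
    qed
  qed
  have quot1: "\<forall>\<^sub>F z in A \<times>\<^sub>F nhds x. case z of (i, y) \<Rightarrow> \<bar>(v i (y + h) - v i y) / h - l\<bar> < 2 * e / 3"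
    using quot[of h] h by (simp add: dist_real_def)
  have quot2: "\<forall>\<^sub>F z in A \<times>\<^sub>F nhds x. case z of (i, y) \<Rightarrow> \<bar>(v i y - v i (y - h)) / h - l\<bar> < 2 * e / 3"
  proof -
    have "(v i (y - h) - v i y) / - h = (v i y - v i (y - h)) / h" for i y
      using h by (simp add: field_simps)
    then show ?thesis using quot[of "- h"] h by (simp add: dist_real_def)
  qed
  have ev: "\<forall>\<^sub>F z in A \<times>\<^sub>F nhds x. case z of (i, y) \<Rightarrow> dist y x < h
      \<and> (\<forall>y\<in>{x - r..x + r}. (v i has_real_derivative p i y) (at y))
      \<and> (\<forall>y\<in>{x - r..x + r}. \<forall>z\<in>{x - r..x + r}. y \<le> z \<longrightarrow> p i y - C * (z - y) \<le> p i z)"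
    using eventually_prodI[OF eventually_conj[OF der semi] near]
    by (auto simp: case_prod_beta elim: eventually_mono)
  show "\<forall>\<^sub>F z in A \<times>\<^sub>F nhds x. dist (case z of (i, y) \<Rightarrow> p i y) l < e"
    using ev quot1 quot2
  proof (eventually_elim, clarify)
    fix i y
    assume y: "dist y x < h"
      and der: "\<forall>y\<in>{x - r..x + r}. (v i has_real_derivative p i y) (at y)"
      and semi: "\<forall>y\<in>{x - r..x + r}. \<forall>z\<in>{x - r..x + r}. y \<le> z \<longrightarrow> p i y - C * (z - y) \<le> p i z"
      and q1: "\<bar>(v i (y + h) - v i y) / h - l\<bar> < 2 * e / 3"
      and q2: "\<bar>(v i y - v i (y - h)) / h - l\<bar> < 2 * e / 3"
    have I: "s \<in> {x - r..x + r}" if "y - h \<le> s" "s \<le> y + h" for s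
      using that y h by (auto simp: dist_real_def abs_less_iff)
    obtain a where a: "y < a" "a < y + h" "v i (y + h) - v i y = (y + h - y) * p i a"
      using MVT2[of y "y + h" "v i" "p i"] der I h by auto
    have up: "p i y - C * h \<le> (v i (y + h) - v i y) / h"
    proof -
      have "p i y - C * (a - y) \<le> p i a" using semi I[of y] I[of a] a h by auto
      moreover have "C * (a - y) \<le> C * h" using a C by (intro mult_left_mono) auto
      ultimately show ?thesis using a(3) h by simp
    qed
    obtain b where b: "y - h < b" "b < y" "v i y - v i (y - h) = (y - (y - h)) * p i b"
      using MVT2[of "y - h" y "v i" "p i"] der I h by auto
    have lo: "(v i y - v i (y - h)) / h - C * h \<le> p i y"
    proof -
      have "p i b - C * (y - b) \<le> p i y" using semi I[of y] I[of b] b h by auto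
      moreover have "C * (y - b) \<le> C * h" using b C by (intro mult_left_mono) auto
      ultimately show ?thesis using b(3) h by simp
    qed
    show "dist (p i y) l < e" using q1 q2 up lo Ch unfolding dist_real_def abs_less_iff by linarith
  qed
qed

section \<open>Limits of primitives\<close>

lemma equi_Lipschitz_pointwise_imp_uniform_limit:
  fixes P :: "'i \<Rightarrow> 'a::metric_space \<Rightarrow> 'b::metric_space"
  assumes K: "compact K" and nontriv: "A \<noteq> bot"
    and lip: "\<forall>\<^sub>F i in A. \<forall>y\<in>K. \<forall>z\<in>K. dist (P i y) (P i z) \<le> B * dist y z"
    and lim: "\<And>y. y \<in> K \<Longrightarrow> ((\<lambda>i. P i y) \<longlongrightarrow> P0 y) A"
  shows "uniform_limit K P P0 A"
proof (rule uniform_limitI)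
  fix e :: real assume e: "0 < e"
  have lip0: "dist (P0 y) (P0 z) \<le> B * dist y z" if "y \<in> K" "z \<in> K" for y z
    by (rule tendsto_upperbound[OF tendsto_dist[OF lim[OF that(1)] lim[OF that(2)]] _ nontriv])
      (use lip that in \<open>auto elim: eventually_mono\<close>)
  define \<delta> where "\<delta> = e / (3 * (\<bar>B\<bar> + 1))"
  have \<delta>: "0 < \<delta>" using e by (simp add: \<delta>_def)
  have small: "B * s \<le> e / 3" if "0 \<le> s" "s < \<delta>" for s
  proof -
    have "B * s \<le> (\<bar>B\<bar> + 1) * \<delta>" using that by (intro mult_mono) auto
    also have "\<dots> = e / 3" by (simp add: \<delta>_def field_simps)
    finally show ?thesis .
  qed
  obtain T where T: "T \<subseteq> K" "finite T" "K \<subseteq> (\<Union>t\<in>T. ball t \<delta>)"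
  proof (rule compactE_image[OF K, of K "\<lambda>t. ball t \<delta>"])
    show "K \<subseteq> (\<Union>t\<in>K. ball t \<delta>)" using \<delta> by force
  qed auto
  have "\<forall>\<^sub>F i in A. \<forall>t\<in>T. dist (P i t) (P0 t) < e / 3"
    using T lim e by (intro eventually_ball_finite ballI tendstoD) auto
  then show "\<forall>\<^sub>F i in A. \<forall>y\<in>K. dist (P i y) (P0 y) < e"
    using lip
  proof eventually_elim
    case (elim i)
    show ?case
    proof
      fix y assume y: "y \<in> K"
      then obtain t where t: "t \<in> T" "dist t y < \<delta>" using T by auto
      have tK: "t \<in> K" using t T by auto
      have "dist (P i y) (P0 y) \<le> dist (P i t) (P i y) + (dist (P i t) (P0 t) + dist (P0 t) (P0 y))"
        by (metis dist_triangle dist_triangle3 add_left_mono order_trans)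
      moreover have "dist (P i t) (P i y) \<le> e / 3" "dist (P0 t) (P0 y) \<le> e / 3"
        using elim(2) lip0 y tK small[OF zero_le_dist t(2)] by (meson order_trans)+
      moreover have "dist (P i t) (P0 t) < e / 3" using elim(1) t by blast
      ultimately show "dist (P i y) (P0 y) < e" by linarith
    qed
  qed
qed

text \<open>The gauge integral makes measurability of the almost everywhere limit \<open>k\<close> automatic: its
  dominated convergence theorem delivers integrability of the limit once the exceptional set has
  been cut out.\<close>

lemma bounded_ae_convergent_integrals_converge:
  fixes h :: "'i::first_countable_topology \<Rightarrow> real \<Rightarrow> real"
  assumes int: "\<And>i. i \<in> I \<Longrightarrow> h i integrable_on {a..b}"
    and bd: "\<And>i y. i \<in> I \<Longrightarrow> y \<in> {a..b} \<Longrightarrow> \<bar>h i y\<bar> \<le> B"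
    and neg: "negligible N"
    and lim: "\<And>y. y \<in> {a..b} - N \<Longrightarrow> ((\<lambda>i. h i y) \<longlongrightarrow> k y) (at i0 within I)"
  shows "\<exists>L. ((\<lambda>i. integral {a..b} (h i)) \<longlongrightarrow> L) (at i0 within I)"
proof
  show "((\<lambda>i. integral {a..b} (h i)) \<longlongrightarrow> integral {a..b} (\<lambda>y. if y \<in> N then 0 else k y)) (at i0 within I)"
    unfolding tendsto_at_iff_sequentially
  proof (intro allI impI)
    fix X assume X: "\<forall>n. X n \<in> I - {i0}" "X \<longlonglongrightarrow> i0"
    have I: "X n \<in> I" for n using X by blast
    have "(\<lambda>n. integral {a..b} (\<lambda>y. if y \<in> N then 0 else h (X n) y))
        \<longlonglongrightarrow> integral {a..b} (\<lambda>y. if y \<in> N then 0 else k y)"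
    proof (rule dominated_convergence(2)[where h = "\<lambda>_. \<bar>B\<bar>"])
      fix n
      show "(\<lambda>y. if y \<in> N then 0 else h (X n) y) integrable_on {a..b}"
        by (rule integrable_spike[OF int[OF I[of n]] neg]) auto
    next
      show "(\<lambda>_. \<bar>B\<bar>) integrable_on {a..b}" by (rule integrable_const_ivl)
    next
      fix n y assume "y \<in> {a..b}"
      then show "norm (if y \<in> N then 0 else h (X n) y) \<le> \<bar>B\<bar>" using bd[OF I, of y n] by auto
    next
      fix y assume "y \<in> {a..b}"
      then show "(\<lambda>n. if y \<in> N then 0 else h (X n) y) \<longlonglongrightarrow> (if y \<in> N then 0 else k y)"
        using lim[of y] X unfolding tendsto_at_iff_sequentially by (auto simp: comp_def)
    qed
    moreover have "integral {a..b} (\<lambda>y. if y \<in> N then 0 else h (X n) y) = integral {a..b} (h (X n))" for n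
      by (rule integral_spike[OF neg]) auto
    ultimately show "((\<lambda>i. integral {a..b} (h i)) \<circ> X) \<longlonglongrightarrow> integral {a..b} (\<lambda>y. if y \<in> N then 0 else k y)"
      by (simp add: comp_def)
  qed
qed

text \<open>Boundedness and almost everywhere convergence of the derivatives \<open>h\<close> alone give the limit
  \<open>Q\<close>: the increments of \<open>P\<close> are integrals of \<open>h\<close>, hence converge, and the local bounds make
  the family equi-Lipschitz. The joint convergence hypothesis is what identifies the derivative
  of \<open>Q\<close> at each point outside \<open>N\<close>: there the derivative of \<open>y \<mapsto> P(y) - k(x) y\<close> is at most
  \<open>e / 2\<close> in absolute value on a neighbourhood of \<open>x\<close> that does not depend on the index, and the resulting Lipschitz estimate
  survives the passage to the limit.\<close>

lemma limit_of_primitives: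
  fixes P h :: "'i::first_countable_topology \<Rightarrow> real \<Rightarrow> real" and k :: "real \<Rightarrow> real"
  assumes nontriv: "at i0 within I \<noteq> bot"
    and der: "\<And>i y. i \<in> I \<Longrightarrow> (P i has_real_derivative h i y) (at y)"
    and P0: "\<And>i. i \<in> I \<Longrightarrow> P i 0 = 0"
    and bd: "\<And>R. \<exists>B. \<forall>i\<in>I. \<forall>y\<in>{-R..R}. \<bar>h i y\<bar> \<le> B"
    and neg: "negligible N"
    and lim: "\<And>x. x \<notin> N \<Longrightarrow> ((\<lambda>(i, y). h i y) \<longlongrightarrow> k x) ((at i0 within I) \<times>\<^sub>F nhds x)"
  shows "\<exists>Q. locally_uniform_limit P Q (at i0 within I) \<and> (\<forall>x. x \<notin> N \<longrightarrow> (Q has_real_derivative k x) (at x))"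
proof -
  let ?A = "at i0 within I"
  have inI: "\<forall>\<^sub>F i in ?A. i \<in> I" by (auto simp: eventually_at_filter)
  have plim: "((\<lambda>i. h i x) \<longlongrightarrow> k x) ?A" if "x \<notin> N" for x
  proof -
    have "filterlim (\<lambda>i. (i, x)) (?A \<times>\<^sub>F nhds x) ?A"
      by (intro filterlim_Pair filterlim_ident tendsto_const)
    from filterlim_compose[OF lim[OF that] this] show ?thesis by simp
  qed
  have ftc: "(h i has_integral (P i b - P i a)) {a..b}" if "i \<in> I" "a \<le> b" for i a b
    using der[OF that(1)] that(2)
    by (intro fundamental_theorem_of_calculus)
      (auto simp: has_real_derivative_iff_has_vector_derivative intro: has_vector_derivative_at_within)
  have inc: "\<exists>L. ((\<lambda>i. P i b - P i a) \<longlongrightarrow> L) ?A" if ab: "a \<le> b" for a b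
  proof -
    define R where "R = max \<bar>a\<bar> \<bar>b\<bar>"
    obtain B where "\<forall>i\<in>I. \<forall>y\<in>{-R..R}. \<bar>h i y\<bar> \<le> B" using bd by blast
    moreover have "{a..b} \<subseteq> {-R..R}" by (auto simp: R_def)
    ultimately have "\<exists>L. ((\<lambda>i. integral {a..b} (h i)) \<longlongrightarrow> L) ?A"
      using has_integral_integrable[OF ftc[OF _ ab]] neg plim
      by (intro bounded_ae_convergent_integrals_converge[where B = B and N = N and k = k])
        (auto simp: subset_eq)
    moreover have "\<forall>\<^sub>F i in ?A. integral {a..b} (h i) = P i b - P i a"
      by (rule eventually_mono[OF inI]) (rule integral_unique[OF ftc[OF _ ab]])
    ultimately show ?thesis by (blast intro: Lim_transform_eventually)
  qed
  have "\<exists>L. ((\<lambda>i. P i x) \<longlongrightarrow> L) ?A" for x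
  proof (cases "0 \<le> x")
    case True
    then obtain L where "((\<lambda>i. P i x - P i 0) \<longlongrightarrow> L) ?A" using inc by blast
    moreover have "\<forall>\<^sub>F i in ?A. P i x - P i 0 = P i x" by (rule eventually_mono[OF inI]) (simp add: P0)
    ultimately show ?thesis by (blast intro: Lim_transform_eventually)
  next
    case False
    then obtain L where "((\<lambda>i. P i 0 - P i x) \<longlongrightarrow> L) ?A" using inc[of x 0] by auto
    then have "((\<lambda>i. - (P i 0 - P i x)) \<longlongrightarrow> - L) ?A" by (rule tendsto_minus)
    moreover have "\<forall>\<^sub>F i in ?A. - (P i 0 - P i x) = P i x" by (rule eventually_mono[OF inI]) (simp add: P0)
    ultimately show ?thesis by (blast intro: Lim_transform_eventually)
  qed
  then obtain Q where Q: "\<And>x. ((\<lambda>i. P i x) \<longlongrightarrow> Q x) ?A" by metis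
  have "locally_uniform_limit P Q ?A"
    unfolding locally_uniform_limit_def
  proof (intro allI impI)
    fix K :: "real set" assume K: "compact K"
    obtain R where R: "\<And>x. x \<in> K \<Longrightarrow> \<bar>x\<bar> \<le> R" using compact_imp_bounded[OF K] by (auto simp: bounded_iff)
    obtain B where B: "\<forall>i\<in>I. \<forall>y\<in>{-R..R}. \<bar>h i y\<bar> \<le> B" using bd by blast
    show "uniform_limit K P Q ?A"
    proof (rule equi_Lipschitz_pointwise_imp_uniform_limit[OF K nontriv _ Q])
      show "\<forall>\<^sub>F i in ?A. \<forall>y\<in>K. \<forall>z\<in>K. dist (P i y) (P i z) \<le> B * dist y z"
      proof (rule eventually_mono[OF inI], intro ballI)
        fix i y z assume i: "i \<in> I" and yz: "y \<in> K" "z \<in> K"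
        have "norm (P i y - P i z) \<le> B * norm (y - z)"
        proof (rule field_differentiable_bound[of "{-R..R}" "P i" "h i"])
          show "y \<in> {-R..R}" "z \<in> {-R..R}" using R[OF yz(1)] R[OF yz(2)] by auto
        qed (use B i der in \<open>auto intro: has_field_derivative_at_within\<close>)
        then show "dist (P i y) (P i z) \<le> B * dist y z" by (simp add: dist_norm)
      qed
    qed
  qed
  moreover have "(Q has_real_derivative k x) (at x)" if x: "x \<notin> N" for x
    unfolding has_field_derivative_iff
  proof (rule tendstoI)
    fix e :: real assume e: "0 < e"
    have "\<forall>\<^sub>F z in ?A \<times>\<^sub>F nhds x. dist (case z of (i, y) \<Rightarrow> h i y) (k x) < e / 2"
      using tendstoD[OF lim[OF x], of "e / 2"] e by simp
    then obtain Pf Pg where Pf: "eventually Pf ?A" and Pg: "eventually Pg (nhds x)"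
      and close: "\<And>i y. Pf i \<Longrightarrow> Pg y \<Longrightarrow> dist (h i y) (k x) < e / 2"
      unfolding eventually_prod_filter by auto
    obtain d where d: "0 < d" "\<And>y. dist y x < d \<Longrightarrow> Pg y"
      using Pg by (auto simp: eventually_nhds_metric)
    have "dist ((Q y - Q x) / (y - x)) (k x) < e" if y: "y \<noteq> x" "dist y x < d" for y
    proof -
      have "\<bar>(Q y - k x * y) - (Q x - k x * x)\<bar> \<le> e / 2 * \<bar>y - x\<bar>"
      proof (rule tendsto_upperbound[OF _ _ nontriv])
        show "((\<lambda>i. \<bar>(P i y - k x * y) - (P i x - k x * x)\<bar>) \<longlongrightarrow> \<bar>(Q y - k x * y) - (Q x - k x * x)\<bar>) ?A"
          by (intro tendsto_intros Q)
        show "\<forall>\<^sub>F i in ?A. \<bar>(P i y - k x * y) - (P i x - k x * x)\<bar> \<le> e / 2 * \<bar>y - x\<bar>"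
          using inI Pf
        proof eventually_elim
          case (elim i)
          have "norm ((P i y - k x * y) - (P i x - k x * x)) \<le> e / 2 * norm (y - x)"
          proof (rule field_differentiable_bound[of "ball x d" "\<lambda>y. P i y - k x * y" "\<lambda>y. h i y - k x"])
            fix z assume z: "z \<in> ball x d"
            show "((\<lambda>y. P i y - k x * y) has_real_derivative h i z - k x) (at z within ball x d)"
              by (auto intro!: derivative_eq_intros has_field_derivative_at_within[OF der] elim)
            show "norm (h i z - k x) \<le> e / 2"
              using less_imp_le[OF close[OF elim(2) d(2), of z]] z by (simp add: dist_commute dist_real_def[symmetric])
          qed (use y d in \<open>auto simp: dist_commute\<close>)
          then show ?case by simp
        qed
      qed
      moreover have "(Q y - k x * y) - (Q x - k x * x) = ((Q y - Q x) / (y - x) - k x) * (y - x)"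
      proof -
        have "(Q y - Q x) / (y - x) * (y - x) = Q y - Q x" using y by simp
        then show ?thesis by (simp only: left_diff_distrib right_diff_distrib)
      qed
      ultimately have "\<bar>(Q y - Q x) / (y - x) - k x\<bar> * \<bar>y - x\<bar> \<le> e / 2 * \<bar>y - x\<bar>"
        by (simp only: abs_mult)
      then have "\<bar>(Q y - Q x) / (y - x) - k x\<bar> \<le> e / 2" using y by simp
      then show ?thesis using e by (simp add: dist_real_def)
    qed
    then show "\<forall>\<^sub>F y in at x. dist ((Q y - Q x) / (y - x)) (k x) < e"
      using d(1) by (auto simp: eventually_at)
  qed
  ultimately show ?thesis by blast
qed

section \<open>The vanishing viscosity limit of the control problem\<close>

theorem lemma2p1:
  fixes M :: "'w measure" and F :: "real \<Rightarrow> 'w measure" and W :: "real \<Rightarrow> 'w \<Rightarrow> real"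
    and f G :: "real \<Rightarrow> real \<Rightarrow> real" and g :: "real \<Rightarrow> real \<Rightarrow> real"
    and \<rho> K \<epsilon>0 :: real
    and V :: "real \<Rightarrow> real \<Rightarrow> real" and V0 :: "real \<Rightarrow> real"
    and Pot :: "real \<Rightarrow> real \<Rightarrow> real" and \<Omega> :: "real set"
  assumes space: "filtered_space_usual M F"
    and BM: "brownian_motion M F W"
    and rho: "0 < \<rho>"
    and f_C1: "C1_on (UNIV \<times> {0<..}) (\<lambda>(x, u). f x u)"
    and f_x_bound: "\<forall>x. \<forall>u>0. \<bar>deriv (\<lambda>y. f y u) x\<bar> \<le> K"
    and f_growth: "\<forall>x. \<forall>u>0. \<bar>f x u\<bar> \<le> K * (1 + \<bar>x\<bar> + \<bar>u\<bar>)"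
    and G_cont: "continuous_on (UNIV \<times> {0<..}) (\<lambda>(x, u). G x u)"
    and G_C1: "\<forall>x. C1_on {0<..} (G x)"
    and V_value: "\<forall>\<epsilon>>0. \<forall>x. ereal (V \<epsilon> x) = value_function M F W \<rho> f G \<epsilon> x"
    and V_C2: "\<forall>\<epsilon>>0. C2_on UNIV (V \<epsilon>)"
    and V_HJB: "\<forall>\<epsilon>>0. \<forall>x.
      - \<epsilon> * deriv (deriv (V \<epsilon>)) x - hamiltonian f G x (deriv (V \<epsilon>) x) + \<rho> * V \<epsilon> x = 0"
    and eps0: "0 < \<epsilon>0"
    and V_bound: "\<forall>A. compact A \<longrightarrow> (\<exists>B. \<forall>\<epsilon> x. 0 < \<epsilon> \<and> \<epsilon> < \<epsilon>0 \<and> x \<in> A \<longrightarrow>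
      \<bar>V \<epsilon> x\<bar> \<le> B \<and> \<bar>deriv (V \<epsilon>) x\<bar> \<le> B)"
    and H_finite: "hamiltonian_finite f G"
    and H_C2: "C2_on UNIV (\<lambda>(x, p). hamiltonian f G x p)"
    and H_pp: "\<forall>x p. deriv (deriv (hamiltonian f G x)) p > 0"
    and g_pos: "\<forall>x p. 0 < g x p"
    and g_cont: "continuous_on UNIV (\<lambda>(x, p). g x p)"
    and optimal: "\<forall>\<epsilon>>0. \<forall>x. \<exists>X.
      optimal_control M F W \<rho> f G \<epsilon> x (\<lambda>s \<omega>. g (X s \<omega>) (deriv (V \<epsilon>) (X s \<omega>))) X"
    and first_order: "\<forall>\<epsilon>>0. \<forall>x.
      deriv (f x) (g x (deriv (V \<epsilon>) x)) * deriv (V \<epsilon>) x + deriv (G x) (g x (deriv (V \<epsilon>) x)) = 0"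
    and V_limit: "locally_uniform_limit V V0 (at_right 0)"
    and V0_viscosity: "viscosity_solution (\<lambda>x r p. - hamiltonian f G x p + \<rho> * r) V0"
    and V0_diff: "AE x in lborel. V0 differentiable (at x)"
    and Pot_deriv: "\<forall>\<epsilon>>0. \<forall>x.
      (Pot \<epsilon> has_real_derivative - f x (g x (deriv (V \<epsilon>) x))) (at x)"
    and Pot_0: "\<forall>\<epsilon>>0. Pot \<epsilon> 0 = 0"
    and Omega: "compact \<Omega>"
  shows "(\<exists>C. \<forall>\<epsilon> x. 0 < \<epsilon> \<and> \<epsilon> < \<epsilon>0 \<and> x \<in> \<Omega> \<longrightarrow> deriv (deriv (V \<epsilon>)) x \<ge> C) \<and>
    (\<exists>Pot0. locally_uniform_limit Pot Pot0 (at_right 0) \<and>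
      (AE x in lborel. (Pot0 has_real_derivative - f x (g x (deriv V0 x))) (at x)))"
proof -
  define \<Phi> where "\<Phi> = (\<lambda>x p. f x (g x p))"
  have semiconvex: "\<exists>C. \<forall>\<epsilon>\<in>{0<..<\<epsilon>0}. \<forall>x\<in>A. C \<le> deriv (deriv (V \<epsilon>)) x" if "compact A" for A
  proof (rule viscous_HJ_second_derivative_lower_bound[where \<rho> = \<rho>, OF _ H_C2 _ _ _ _ that])
    fix B :: "real set" assume "compact B"
    then show "\<exists>b. \<forall>\<epsilon>\<in>{0<..<\<epsilon>0}. \<forall>x\<in>B. \<bar>deriv (V \<epsilon>) x\<bar> \<le> b"
      using V_bound by (metis greaterThanLessThan_iff)
  qed (use rho H_pp V_C2 V_HJB in auto)
  have V': "(V \<epsilon> has_real_derivative deriv (V \<epsilon>) x) (at x)"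
    and V'': "(deriv (V \<epsilon>) has_real_derivative deriv (deriv (V \<epsilon>)) x) (at x)" if "\<epsilon> > 0" for \<epsilon> x
    using C2_on_real_derivatives[of "V \<epsilon>"] V_C2 that by auto
  have right: "at 0 within {0<..<\<epsilon>0} = at_right 0"
    by (rule at_within_nhd[of _ "{..<\<epsilon>0}"]) (use eps0 in auto)
  have small: "\<forall>\<^sub>F \<epsilon> in at_right 0. \<epsilon> \<in> {0<..<\<epsilon>0}"
    using eventually_at_right_less eps0 by (auto simp: eventually_at_right_field)
  have V'_lim: "((\<lambda>(\<epsilon>, y). deriv (V \<epsilon>) y) \<longlongrightarrow> deriv V0 x) (at_right 0 \<times>\<^sub>F nhds x)"
    if x: "V0 differentiable (at x)" for x
  proof -
    obtain C where C: "\<forall>\<epsilon>\<in>{0<..<\<epsilon>0}. \<forall>y\<in>{x - 1..x + 1}. C \<le> deriv (deriv (V \<epsilon>)) y"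
      using semiconvex[OF compact_Icc] by blast
    show ?thesis
    proof (rule semimonotone_derivatives_tendsto[where r = 1 and C = "\<bar>C\<bar>" and v = V and ?v0.0 = V0])
      show "\<forall>\<^sub>F \<epsilon> in at_right 0. \<forall>y\<in>{x - 1..x + 1}. \<forall>z\<in>{x - 1..x + 1}.
          y \<le> z \<longrightarrow> deriv (V \<epsilon>) y - \<bar>C\<bar> * (z - y) \<le> deriv (V \<epsilon>) z"
      proof (rule eventually_mono[OF small], intro ballI impI)
        fix \<epsilon> y z
        assume \<epsilon>: "\<epsilon> \<in> {0<..<\<epsilon>0}" and y: "y \<in> {x - 1..x + 1}" and z: "z \<in> {x - 1..x + 1}" and yz: "y \<le> z"
        have "deriv (V \<epsilon>) y + \<bar>C\<bar> * y \<le> deriv (V \<epsilon>) z + \<bar>C\<bar> * z"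
        proof (rule DERIV_nonneg_imp_nondecreasing[OF yz])
          fix s assume s: "y \<le> s" "s \<le> z"
          have "C \<le> deriv (deriv (V \<epsilon>)) s" using C \<epsilon> s y z by auto
          then show "\<exists>m. ((\<lambda>s. deriv (V \<epsilon>) s + \<bar>C\<bar> * s) has_real_derivative m) (at s) \<and> 0 \<le> m"
            using V''[of \<epsilon> s] \<epsilon>
            by (intro exI[of _ "deriv (deriv (V \<epsilon>)) s + \<bar>C\<bar>"]) (auto intro!: derivative_eq_intros)
        qed
        then show "deriv (V \<epsilon>) y - \<bar>C\<bar> * (z - y) \<le> deriv (V \<epsilon>) z" by (simp add: algebra_simps)
      qed
      show "\<forall>\<^sub>F \<epsilon> in at_right 0. \<forall>y\<in>{x - 1..x + 1}. (V \<epsilon> has_real_derivative deriv (V \<epsilon>) y) (at y)"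
        by (rule eventually_mono[OF small]) (use V' in auto)
      show "uniform_limit {x - 1..x + 1} V V0 (at_right 0)"
        using V_limit by (auto simp: locally_uniform_limit_def)
      show "continuous_on UNIV V0" using V0_viscosity by (simp add: viscosity_solution_def)
      show "(V0 has_real_derivative deriv V0 x) (at x)"
        using x by (simp add: DERIV_deriv_iff_real_differentiable)
    qed auto
  qed
  have \<Phi>_cont: "continuous_on UNIV (\<lambda>(x, p). \<Phi> x p)"
  proof -
    have "continuous_on (UNIV \<times> {0<..}) (\<lambda>(x, u). f x u)"
      using f_C1 unfolding C1_on_def
      by (intro continuous_at_imp_continuous_on ballI) (metis has_derivative_continuous)
    moreover have "continuous_on UNIV (\<lambda>z. (fst z, g (fst z) (snd z)))"
      using g_cont by (intro continuous_intros) (simp add: case_prod_beta)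
    ultimately have "continuous_on UNIV (\<lambda>z. (\<lambda>(x, u). f x u) (fst z, g (fst z) (snd z)))"
      by (rule continuous_on_compose2) (use g_pos in auto)
    then show ?thesis by (simp add: \<Phi>_def case_prod_beta)
  qed
  define N where "N = {x. \<not> V0 differentiable (at x)}"
  have "\<exists>Q. locally_uniform_limit Pot Q (at 0 within {0<..<\<epsilon>0})
      \<and> (\<forall>x. x \<notin> N \<longrightarrow> (Q has_real_derivative - \<Phi> x (deriv V0 x)) (at x))"
  proof (rule limit_of_primitives)
    show "at 0 within {0<..<\<epsilon>0} \<noteq> bot" by (simp add: right)
    show "negligible N"
    proof -
      obtain Z where "Z \<in> null_sets lborel" "N \<subseteq> Z"
        using V0_diff unfolding N_def eventually_ae_filter by auto
      then show ?thesis
        by (metis negligible_iff_null_sets negligible_subset null_sets_completionI)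
    qed
    show "(Pot \<epsilon> has_real_derivative - \<Phi> y (deriv (V \<epsilon>) y)) (at y)" if "\<epsilon> \<in> {0<..<\<epsilon>0}" for \<epsilon> y
      using Pot_deriv that by (simp add: \<Phi>_def)
    show "Pot \<epsilon> 0 = 0" if "\<epsilon> \<in> {0<..<\<epsilon>0}" for \<epsilon> using Pot_0 that by simp
    show "\<exists>B. \<forall>\<epsilon>\<in>{0<..<\<epsilon>0}. \<forall>y\<in>{-R..R}. \<bar>- \<Phi> y (deriv (V \<epsilon>) y)\<bar> \<le> B" for R
    proof -
      obtain b where b: "\<forall>\<epsilon> x. 0 < \<epsilon> \<and> \<epsilon> < \<epsilon>0 \<and> x \<in> {-R..R} \<longrightarrow> \<bar>V \<epsilon> x\<bar> \<le> b \<and> \<bar>deriv (V \<epsilon>) x\<bar> \<le> b"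
        using V_bound compact_Icc by metis
      have "bounded ((\<lambda>(x, p). \<Phi> x p) ` ({-R..R} \<times> {-b..b}))"
        using continuous_on_subset[OF \<Phi>_cont]
        by (intro compact_imp_bounded compact_continuous_image compact_Times) auto
      then obtain B where B: "\<forall>z\<in>{-R..R} \<times> {-b..b}. \<bar>(\<lambda>(x, p). \<Phi> x p) z\<bar> \<le> B"
        by (auto simp: bounded_iff)
      have "\<bar>- \<Phi> y (deriv (V \<epsilon>) y)\<bar> \<le> B" if "\<epsilon> \<in> {0<..<\<epsilon>0}" "y \<in> {-R..R}" for \<epsilon> y
      proof -
        have "(y, deriv (V \<epsilon>) y) \<in> {-R..R} \<times> {-b..b}"
          using b[rule_format, of \<epsilon> y] that by (auto simp: abs_le_iff)
        from bspec[OF B this] show ?thesis by simp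
      qed
      then show ?thesis by blast
    qed
    fix x assume "x \<notin> N"
    then have "((\<lambda>z. (snd z, (\<lambda>(\<epsilon>, y). deriv (V \<epsilon>) y) z)) \<longlongrightarrow> (x, deriv V0 x)) (at_right 0 \<times>\<^sub>F nhds x)"
      by (intro tendsto_Pair filterlim_snd V'_lim) (simp add: N_def)
    moreover have "isCont (\<lambda>(x, p). \<Phi> x p) (x, deriv V0 x)"
      using \<Phi>_cont by (simp add: continuous_on_eq_continuous_at)
    ultimately have "((\<lambda>z. (\<lambda>(x, p). \<Phi> x p) (snd z, (\<lambda>(\<epsilon>, y). deriv (V \<epsilon>) y) z))
        \<longlongrightarrow> (\<lambda>(x, p). \<Phi> x p) (x, deriv V0 x)) (at_right 0 \<times>\<^sub>F nhds x)"
      by (rule isCont_tendsto_compose[rotated])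
    then show "((\<lambda>(\<epsilon>, y). - \<Phi> y (deriv (V \<epsilon>) y)) \<longlongrightarrow> - \<Phi> x (deriv V0 x))
        ((at 0 within {0<..<\<epsilon>0}) \<times>\<^sub>F nhds x)"
      unfolding right by (auto intro: tendsto_minus simp: split_def)
  qed
  then obtain Q where Q: "locally_uniform_limit Pot Q (at_right 0)"
    "\<And>x. V0 differentiable (at x) \<Longrightarrow> (Q has_real_derivative - \<Phi> x (deriv V0 x)) (at x)"
    unfolding right N_def by blast
  have "AE x in lborel. (Q has_real_derivative - f x (g x (deriv V0 x))) (at x)"
    using V0_diff by (rule eventually_mono) (use Q(2) in \<open>simp add: \<Phi>_def\<close>)
  moreover have "\<exists>C. \<forall>\<epsilon> x. 0 < \<epsilon> \<and> \<epsilon> < \<epsilon>0 \<and> x \<in> \<Omega> \<longrightarrow> C \<le> deriv (deriv (V \<epsilon>)) x"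
    using semiconvex[OF Omega] by (meson greaterThanLessThan_iff)
  ultimately show ?thesis using Q(1) by blast
qed

end
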